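(* Let $\phi$ be a complete $L_{\omega_1,\omega}(\tau)$-sentence, and let $\tau^\phi$, $T^\phi$, $\sigma$ and $T^{\hat\phi}$ be as described in the context. If a model $B$ of $T^{\hat\phi}$ satisfies the $G$-$\omega$-rule, then the $\tau^\phi$-structure on its sort $V(B)$ is an atomic model of $T^\phi$; i.e. every complete type over $\emptyset$ realized in $V(B)$ is principal as a $\tau^\phi$-type. Consequently the $\tau$-reducts of (the $V$-parts of) models of $T^{\hat\phi}$ plus the $G$-$\omega$-rule are exactly the models of $\phi$; that is, $\phi$ and $T^{\hat\phi}+G$-$\omega$-rule are structurally equivalent (determine the same class of $\tau$-structures).
   Context: $L_{\omega_1,\omega}$ extends first-order logic by countable conjunctions and disjunctions (with finitely many free variables overall). A sentence $\phi$ is complete if for every $L_{\omega_1,\omega}$-sentence $\psi$, $\phi\vdash\psi$ or $\phi\vdash\neg\psi$. By Chang's theorem there are a countable vocabulary $\tau^\phi\supseteq\tau$ and a first-order $\tau^\phi$-theory $T^\phi$ such that (for complete $\phi$) the models of $\phi$ are exactly the $\tau$-reducts of the atomic models of $T^\phi$. A model $M$ of a first-order theory is atomic if every finite tuple in $M$ realizes a principal (isolated) type over $\emptyset$. $\sigma$ is a two-sorted vocabulary with disjoint sorts $N$ and $V$: $N$ contains distinct constants $c_{n,i}$ ($n,i<\omega$); $V$ carries a $\tau^\phi$-structure (each $\tau^\phi$-constant becomes a constant of sort $V$); and for each $n$ there is an $(n+1)$-ary relation $R^n\subseteq N\times V^n$. Fix an injective enumeration $\phi_i(\bar v)$ ($i<\omega$)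 of formulas generating the principal $n$-types of $T^\phi$ over $\emptyset$. $T^{\hat\phi}$ consists of $T^\phi$ relativized to $V$; the axioms $c_{n,i}\neq c_{m,j}$ for distinct indices and $N(c_{n,i})$; the axioms $(\forall\bar v)[R^n(c_{n,i},\bar v)\leftrightarrow\phi_i(\bar v)]$; and $(\forall\bar v)[V(\bar v)\to\exists w(N(w)\wedge R^n(w,\bar v))]$. The $G$-$\omega$-rule: for any countable set of constants $B\supseteq\mathrm{Const}(\sigma)$ and $\sigma(B)$-formula $\psi(x,\bar d)$ with $\mathrm{lg}(\bar d)=n$, from all $\psi(c_{n,i},\bar d)$ ($n,i<\omega$) together with $(\forall x)(\forall\bar v)(\psi(x,\bar d)\to(N(x)\wedge\bigwedge_{i<n}V(v_i)))$ infer $(\forall x)(N(x)\to\psi(x,\bar d))$. A model satisfies the $G$-$\omega$-rule if it carries an admissible valuation (all instances of the rule, and of $\forall$-elimination for constants in $B$, preserve truth).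
   Formalization: The theory T^φ̂ gets added axioms that R^n(c_{m,i}, v̄) fails for m ≠ n (without them the claim is false); the rule's second premise is read with ψ(x, v̄), and the rule is required for every countable B and every interpretation of its additional constants. *)

theory Defs
  imports Main "HOL-Library.Countable_Set"
begin

text \<open>
  A vocabulary assigns arities to its function and relation symbols; constants are the
  function symbols of arity 0.  Structures have a carrier inside an ambient type
  \<open>'u\<close>; what a structure does with symbols outside the vocabulary, or with
  arguments outside the carrier, is irrelevant.
\<close>

record ('f, 'r) voc =
  Fsig :: "'f \<Rightarrow> nat option"
  Rsig :: "'r \<Rightarrow> nat option"

definition subvoc :: "('f, 'r) voc \<Rightarrow> ('f, 'r) voc \<Rightarrow> bool" where
  "subvoc \<tau> \<tau>' \<longleftrightarrow> Fsig \<tau> \<subseteq>\<^sub>m Fsig \<tau>' \<and> Rsig \<tau> \<subseteq>\<^sub>m Rsig \<tau>'"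

definition countable_voc :: "('f, 'r) voc \<Rightarrow> bool" where
  "countable_voc \<tau> \<longleftrightarrow> countable (dom (Fsig \<tau>)) \<and> countable (dom (Rsig \<tau>))"

definition consts_of :: "('f, 'r) voc \<Rightarrow> 'f set" where
  "consts_of \<tau> = {f. Fsig \<tau> f = Some 0}"

record ('f, 'r, 'u) str =
  Dom :: "'u set"
  Fn :: "'f \<Rightarrow> 'u list \<Rightarrow> 'u"
  Rl :: "'r \<Rightarrow> 'u list \<Rightarrow> bool"

definition tuples :: "('f, 'r, 'u) str \<Rightarrow> nat \<Rightarrow> 'u list set" where
  "tuples M n = {as. length as = n \<and> set as \<subseteq> Dom M}"

definition is_str :: "('f, 'r) voc \<Rightarrow> ('f, 'r, 'u) str \<Rightarrow> bool" where
  "is_str \<tau> M \<longleftrightarrow> Dom M \<noteq> {} \<and>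
     (\<forall>f k. Fsig \<tau> f = Some k \<longrightarrow> (\<forall>as \<in> tuples M k. Fn M f as \<in> Dom M))"

definition is_reduct :: "('f, 'r) voc \<Rightarrow> ('f, 'r, 'u) str \<Rightarrow> ('f, 'r, 'u) str \<Rightarrow> bool" where
  "is_reduct \<tau> M M' \<longleftrightarrow> Dom M = Dom M' \<and>
     (\<forall>f k. Fsig \<tau> f = Some k \<longrightarrow> (\<forall>as \<in> tuples M k. Fn M f as = Fn M' f as)) \<and>
     (\<forall>r k. Rsig \<tau> r = Some k \<longrightarrow> (\<forall>as \<in> tuples M k. Rl M r as = Rl M' r as))"

definition iso_str :: "('f, 'r) voc \<Rightarrow> ('f, 'r, 'u) str \<Rightarrow> ('f, 'r, 'w) str \<Rightarrow> bool" where
  "iso_str \<tau> M M' \<longleftrightarrow> (\<exists>h. bij_betw h (Dom M) (Dom M') \<and>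
     (\<forall>f k. Fsig \<tau> f = Some k \<longrightarrow>
        (\<forall>as \<in> tuples M k. h (Fn M f as) = Fn M' f (map h as))) \<and>
     (\<forall>r k. Rsig \<tau> r = Some k \<longrightarrow>
        (\<forall>as \<in> tuples M k. Rl M r as = Rl M' r (map h as))))"

datatype 'f tm = Var nat | App 'f "'f tm list"

datatype ('f, 'r) fm =
    Bot
  | Eq "'f tm" "'f tm"
  | Rel 'r "'f tm list"
  | Imp "('f, 'r) fm" "('f, 'r) fm"
  | Forall nat "('f, 'r) fm"

abbreviation Neg :: "('f, 'r) fm \<Rightarrow> ('f, 'r) fm" where
  "Neg p \<equiv> Imp p Bot"

abbreviation Conj :: "('f, 'r) fm \<Rightarrow> ('f, 'r) fm \<Rightarrow> ('f, 'r) fm" where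
  "Conj p q \<equiv> Neg (Imp p (Neg q))"

abbreviation Iff :: "('f, 'r) fm \<Rightarrow> ('f, 'r) fm \<Rightarrow> ('f, 'r) fm" where
  "Iff p q \<equiv> Conj (Imp p q) (Imp q p)"

abbreviation Exists :: "nat \<Rightarrow> ('f, 'r) fm \<Rightarrow> ('f, 'r) fm" where
  "Exists x p \<equiv> Neg (Forall x (Neg p))"

primrec Foralls :: "nat \<Rightarrow> ('f, 'r) fm \<Rightarrow> ('f, 'r) fm" where
  "Foralls 0 p = p"
| "Foralls (Suc n) p = Foralls n (Forall n p)"

primrec BigConj :: "nat \<Rightarrow> (nat \<Rightarrow> ('f, 'r) fm) \<Rightarrow> ('f, 'r) fm" where
  "BigConj 0 F = Neg Bot"
| "BigConj (Suc n) F = Conj (BigConj n F) (F n)"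

primrec tmvars :: "'f tm \<Rightarrow> nat set" where
  "tmvars (Var x) = {x}"
| "tmvars (App f ts) = \<Union> (set (map tmvars ts))"

primrec fv :: "('f, 'r) fm \<Rightarrow> nat set" where
  "fv Bot = {}"
| "fv (Eq s t) = tmvars s \<union> tmvars t"
| "fv (Rel r ts) = \<Union> (set (map tmvars ts))"
| "fv (Imp p q) = fv p \<union> fv q"
| "fv (Forall x p) = fv p - {x}"

primrec tm_in :: "('f, 'r) voc \<Rightarrow> 'f tm \<Rightarrow> bool" where
  "tm_in \<tau> (Var x) = True"
| "tm_in \<tau> (App f ts) = (Fsig \<tau> f = Some (length ts) \<and> list_all id (map (tm_in \<tau>) ts))"

primrec fm_in :: "('f, 'r) voc \<Rightarrow> ('f, 'r) fm \<Rightarrow> bool" where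
  "fm_in \<tau> Bot = True"
| "fm_in \<tau> (Eq s t) = (tm_in \<tau> s \<and> tm_in \<tau> t)"
| "fm_in \<tau> (Rel r ts) = (Rsig \<tau> r = Some (length ts) \<and> list_all (tm_in \<tau>) ts)"
| "fm_in \<tau> (Imp p q) = (fm_in \<tau> p \<and> fm_in \<tau> q)"
| "fm_in \<tau> (Forall x p) = fm_in \<tau> p"

definition sentences :: "('f, 'r) voc \<Rightarrow> ('f, 'r) fm set" where
  "sentences \<tau> = {p. fm_in \<tau> p \<and> fv p = {}}"

primrec tmval :: "('f, 'r, 'u) str \<Rightarrow> (nat \<Rightarrow> 'u) \<Rightarrow> 'f tm \<Rightarrow> 'u" where
  "tmval M e (Var x) = e x"
| "tmval M e (App f ts) = Fn M f (map (tmval M e) ts)"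

primrec sat :: "('f, 'r, 'u) str \<Rightarrow> (nat \<Rightarrow> 'u) \<Rightarrow> ('f, 'r) fm \<Rightarrow> bool" where
  "sat M e Bot = False"
| "sat M e (Eq s t) = (tmval M e s = tmval M e t)"
| "sat M e (Rel r ts) = Rl M r (map (tmval M e) ts)"
| "sat M e (Imp p q) = (sat M e p \<longrightarrow> sat M e q)"
| "sat M e (Forall x p) = (\<forall>a \<in> Dom M. sat M (e(x := a)) p)"

text \<open>Truth of a formula under all assignments; for sentences this is truth.\<close>

definition true_in :: "('f, 'r, 'u) str \<Rightarrow> ('f, 'r) fm \<Rightarrow> bool" where
  "true_in M p \<longleftrightarrow> (\<forall>e. range e \<subseteq> Dom M \<longrightarrow> sat M e p)"

definition model_of :: "('f, 'r) voc \<Rightarrow> ('f, 'r) fm set \<Rightarrow> ('f, 'r, 'u) str \<Rightarrow> bool" where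
  "model_of \<tau> T M \<longleftrightarrow> is_str \<tau> M \<and> (\<forall>p \<in> T. true_in M p)"

text \<open>
  Consequence is semantic, over the structures with carrier in \<open>'u\<close>.  For countable
  vocabularies and infinite \<open>'u\<close> this is consequence over all structures
  (Loewenheim-Skolem), hence derivability.
\<close>

definition entails :: "'u itself \<Rightarrow> ('f, 'r) voc \<Rightarrow> ('f, 'r) fm set \<Rightarrow> ('f, 'r) fm \<Rightarrow> bool" where
  "entails U \<tau> T p \<longleftrightarrow> (\<forall>M :: ('f, 'r, 'u) str. model_of \<tau> T M \<longrightarrow> true_in M p)"

text \<open>Substitution; it is only used with constants or a variable for itself, so there is no capture.\<close>

primrec tmsubst :: "(nat \<Rightarrow> 'f tm) \<Rightarrow> 'f tm \<Rightarrow> 'f tm" where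
  "tmsubst s (Var x) = s x"
| "tmsubst s (App f ts) = App f (map (tmsubst s) ts)"

primrec subst :: "(nat \<Rightarrow> 'f tm) \<Rightarrow> ('f, 'r) fm \<Rightarrow> ('f, 'r) fm" where
  "subst s Bot = Bot"
| "subst s (Eq t u) = Eq (tmsubst s t) (tmsubst s u)"
| "subst s (Rel r ts) = Rel r (map (tmsubst s) ts)"
| "subst s (Imp p q) = Imp (subst s p) (subst s q)"
| "subst s (Forall x p) = Forall x (subst (s(x := Var x)) p)"

text \<open>The variables of an \<open>n\<close>-type are \<open>Var 0, \<dots>, Var (n - 1)\<close>.\<close>

definition tp :: "('f, 'r) voc \<Rightarrow> ('f, 'r, 'u) str \<Rightarrow> 'u list \<Rightarrow> ('f, 'r) fm set" where
  "tp \<tau> M as = {p. fm_in \<tau> p \<and> fv p \<subseteq> {..<length as} \<and> sat M (nth as) p}"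

definition complete_type ::
  "'u itself \<Rightarrow> ('f, 'r) voc \<Rightarrow> ('f, 'r) fm set \<Rightarrow> nat \<Rightarrow> ('f, 'r) fm set \<Rightarrow> bool" where
  "complete_type U \<tau> T n p \<longleftrightarrow>
     (\<exists>M :: ('f, 'r, 'u) str. model_of \<tau> T M \<and> (\<exists>as \<in> tuples M n. p = tp \<tau> M as))"

definition generates ::
  "'u itself \<Rightarrow> ('f, 'r) voc \<Rightarrow> ('f, 'r) fm set \<Rightarrow> ('f, 'r) fm \<Rightarrow> ('f, 'r) fm set \<Rightarrow> bool" where
  "generates U \<tau> T \<theta> p \<longleftrightarrow> \<theta> \<in> p \<and> (\<forall>\<chi> \<in> p. entails U \<tau> T (Imp \<theta> \<chi>))"

definition principal ::
  "'u itself \<Rightarrow> ('f, 'r) voc \<Rightarrow> ('f, 'r) fm set \<Rightarrow> ('f, 'r) fm set \<Rightarrow> bool" where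
  "principal U \<tau> T p \<longleftrightarrow> (\<exists>\<theta>. generates U \<tau> T \<theta> p)"

definition atomic_model :: "('f, 'r) voc \<Rightarrow> ('f, 'r) fm set \<Rightarrow> ('f, 'r, 'u) str \<Rightarrow> bool" where
  "atomic_model \<tau> T M \<longleftrightarrow> model_of \<tau> T M \<and>
     (\<forall>n. \<forall>as \<in> tuples M n. principal TYPE('u) \<tau> T (tp \<tau> M as))"

text \<open>
  \<open>E n\<close> lists, without repetition, formulas generating principal \<open>n\<close>-types,
  every principal \<open>n\<close>-type being generated by one of them.  Distinct formulas may
  generate the same type, so there may be finitely many principal \<open>n\<close>-types.
\<close>

definition enumerates_principal_types ::
  "'u itself \<Rightarrow> ('f, 'r) voc \<Rightarrow> ('f, 'r) fm set \<Rightarrow> (nat \<Rightarrow> nat \<Rightarrow> ('f, 'r) fm) \<Rightarrow> bool" where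
  "enumerates_principal_types U \<tau> T E \<longleftrightarrow> (\<forall>n.
     inj (E n) \<and>
     (\<forall>i. \<exists>p. complete_type U \<tau> T n p \<and> generates U \<tau> T (E n i) p) \<and>
     (\<forall>p. complete_type U \<tau> T n p \<and> principal U \<tau> T p \<longrightarrow> (\<exists>i. generates U \<tau> T (E n i) p)))"

text \<open>Disjunctions and existential quantifiers are obtained by negation.\<close>

datatype ('f, 'r) ifm =
    IEq "'f tm" "'f tm"
  | IRel 'r "'f tm list"
  | INeg "('f, 'r) ifm"
  | IConj "nat \<Rightarrow> ('f, 'r) ifm"
  | IForall nat "('f, 'r) ifm"

primrec ifv :: "('f, 'r) ifm \<Rightarrow> nat set" where
  "ifv (IEq s t) = tmvars s \<union> tmvars t"
| "ifv (IRel r ts) = \<Union> (set (map tmvars ts))"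
| "ifv (INeg p) = ifv p"
| "ifv (IConj F) = (\<Union>i. ifv (F i))"
| "ifv (IForall x p) = ifv p - {x}"

primrec ifm_in :: "('f, 'r) voc \<Rightarrow> ('f, 'r) ifm \<Rightarrow> bool" where
  "ifm_in \<tau> (IEq s t) = (tm_in \<tau> s \<and> tm_in \<tau> t)"
| "ifm_in \<tau> (IRel r ts) = (Rsig \<tau> r = Some (length ts) \<and> list_all (tm_in \<tau>) ts)"
| "ifm_in \<tau> (INeg p) = ifm_in \<tau> p"
| "ifm_in \<tau> (IConj F) = ((\<forall>i. ifm_in \<tau> (F i)) \<and> finite (\<Union>i. ifv (F i)))"
| "ifm_in \<tau> (IForall x p) = ifm_in \<tau> p"

definition isentences :: "('f, 'r) voc \<Rightarrow> ('f, 'r) ifm set" where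
  "isentences \<tau> = {p. ifm_in \<tau> p \<and> ifv p = {}}"

primrec isat :: "('f, 'r, 'u) str \<Rightarrow> (nat \<Rightarrow> 'u) \<Rightarrow> ('f, 'r) ifm \<Rightarrow> bool" where
  "isat M e (IEq s t) = (tmval M e s = tmval M e t)"
| "isat M e (IRel r ts) = Rl M r (map (tmval M e) ts)"
| "isat M e (INeg p) = (\<not> isat M e p)"
| "isat M e (IConj F) = (\<forall>i. isat M e (F i))"
| "isat M e (IForall x p) = (\<forall>a \<in> Dom M. isat M (e(x := a)) p)"

definition imodel_of :: "('f, 'r) voc \<Rightarrow> ('f, 'r) ifm \<Rightarrow> ('f, 'r, 'u) str \<Rightarrow> bool" where
  "imodel_of \<tau> p M \<longleftrightarrow> is_str \<tau> M \<and> (\<forall>e. range e \<subseteq> Dom M \<longrightarrow> isat M e p)"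

definition ientails :: "'u itself \<Rightarrow> ('f, 'r) voc \<Rightarrow> ('f, 'r) ifm \<Rightarrow> ('f, 'r) ifm \<Rightarrow> bool" where
  "ientails U \<tau> p q \<longleftrightarrow> (\<forall>M :: ('f, 'r, 'u) str. imodel_of \<tau> p M \<longrightarrow> imodel_of \<tau> q M)"

definition complete_isentence :: "'u itself \<Rightarrow> ('f, 'r) voc \<Rightarrow> ('f, 'r) ifm \<Rightarrow> bool" where
  "complete_isentence U \<tau> p \<longleftrightarrow> p \<in> isentences \<tau> \<and>
     (\<forall>q \<in> isentences \<tau>. ientails U \<tau> p q \<or> ientails U \<tau> p (INeg q))"

text \<open>
  The sorts are unary predicates.  \<open>Code n i\<close> is the constant \<open>c\<^sub>n\<^sub>,\<^sub>i\<close>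
  and \<open>RN n\<close> is the relation \<open>R\<^sup>n\<close>, its argument of sort \<open>N\<close> coming
  first.  The symbols \<open>New k\<close> are not in the vocabulary; they are a supply of fresh
  constants.
\<close>

datatype 'f sfun = TauF 'f | Code nat nat | New nat

datatype 'r srel = TauR 'r | SortN | SortV | RN nat

primrec sigma_far :: "('f, 'r) voc \<Rightarrow> 'f sfun \<Rightarrow> nat option" where
  "sigma_far \<tau> (TauF f) = Fsig \<tau> f"
| "sigma_far \<tau> (Code n i) = Some 0"
| "sigma_far \<tau> (New k) = None"

primrec sigma_rar :: "('f, 'r) voc \<Rightarrow> 'r srel \<Rightarrow> nat option" where
  "sigma_rar \<tau> (TauR r) = Rsig \<tau> r"
| "sigma_rar \<tau> SortN = Some 1"
| "sigma_rar \<tau> SortV = Some 1"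
| "sigma_rar \<tau> (RN n) = Some (Suc n)"

definition sigma :: "('f, 'r) voc \<Rightarrow> ('f sfun, 'r srel) voc" where
  "sigma \<tau> = \<lparr>Fsig = sigma_far \<tau>, Rsig = sigma_rar \<tau>\<rparr>"

definition inN :: "('f sfun, 'r srel, 'u) str \<Rightarrow> 'u set" where
  "inN M = {a \<in> Dom M. Rl M SortN [a]}"

definition inV :: "('f sfun, 'r srel, 'u) str \<Rightarrow> 'u set" where
  "inV M = {a \<in> Dom M. Rl M SortV [a]}"

text \<open>
  In a two-sorted structure the functions of \<open>\<tau>\<close> live on \<open>V\<close> only.  To have total
  functions, such a function returns its first argument when some argument is outside
  \<open>V\<close>; this choice makes no new sets definable.
\<close>

definition is_sigma_str :: "('f, 'r) voc \<Rightarrow> ('f sfun, 'r srel, 'u) str \<Rightarrow> bool" where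
  "is_sigma_str \<tau> M \<longleftrightarrow> is_str (sigma \<tau>) M \<and>
     inV M \<noteq> {} \<and> inN M \<inter> inV M = {} \<and> inN M \<union> inV M = Dom M \<and>
     (\<forall>f k. Fsig \<tau> f = Some k \<longrightarrow> (\<forall>as \<in> tuples M k.
        if set as \<subseteq> inV M then Fn M (TauF f) as \<in> inV M else Fn M (TauF f) as = hd as)) \<and>
     (\<forall>r k. Rsig \<tau> r = Some k \<longrightarrow> (\<forall>as \<in> tuples M k. Rl M (TauR r) as \<longrightarrow> set as \<subseteq> inV M)) \<and>
     (\<forall>n. \<forall>a as. a # as \<in> tuples M (Suc n) \<longrightarrow> Rl M (RN n) (a # as) \<longrightarrow>
        a \<in> inN M \<and> set as \<subseteq> inV M)"

definition Vpart :: "('f sfun, 'r srel, 'u) str \<Rightarrow> ('f, 'r, 'u) str" where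
  "Vpart M = \<lparr>Dom = inV M, Fn = (\<lambda>f. Fn M (TauF f)), Rl = (\<lambda>r. Rl M (TauR r))\<rparr>"

abbreviation cst :: "'f \<Rightarrow> 'f tm" where
  "cst c \<equiv> App c []"

abbreviation isN :: "'f sfun tm \<Rightarrow> ('f sfun, 'r srel) fm" where
  "isN t \<equiv> Rel SortN [t]"

abbreviation isV :: "'f sfun tm \<Rightarrow> ('f sfun, 'r srel) fm" where
  "isV t \<equiv> Rel SortV [t]"

abbreviation allV :: "nat \<Rightarrow> ('f sfun, 'r srel) fm" where
  "allV n \<equiv> BigConj n (\<lambda>i. isV (Var i))"

abbreviation Rn :: "nat \<Rightarrow> 'f sfun tm \<Rightarrow> ('f sfun, 'r srel) fm" where
  "Rn n t \<equiv> Rel (RN n) (t # map Var [0..<n])"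

primrec relV :: "('f, 'r) fm \<Rightarrow> ('f sfun, 'r srel) fm" where
  "relV Bot = Bot"
| "relV (Eq s t) = Eq (map_tm TauF s) (map_tm TauF t)"
| "relV (Rel r ts) = Rel (TauR r) (map (map_tm TauF) ts)"
| "relV (Imp p q) = Imp (relV p) (relV q)"
| "relV (Forall x p) = Forall x (Imp (isV (Var x)) (relV p))"

text \<open>
  The constants \<open>c\<^sub>m\<^sub>,\<^sub>i\<close> code \<open>m\<close>-types only: \<open>R\<^sup>n\<close> holds of no
  \<open>c\<^sub>m\<^sub>,\<^sub>i\<close> with \<open>m \<noteq> n\<close>.  Without the axioms saying so, \<open>R\<^sup>n\<close> could
  be made to hold of \<open>c\<^sub>m\<^sub>,\<^sub>i\<close> and all \<open>n\<close>-tuples, and the covering axioms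
  (the last family) would say nothing about \<open>V\<close>.
\<close>

definition That ::
  "('f, 'r) fm set \<Rightarrow> (nat \<Rightarrow> nat \<Rightarrow> ('f, 'r) fm) \<Rightarrow> ('f sfun, 'r srel) fm set" where
  "That T E =
     relV ` T
   \<union> {Neg (Eq (cst (Code n i)) (cst (Code m j))) | n i m j. (n, i) \<noteq> (m, j)}
   \<union> {isN (cst (Code n i)) | n i. True}
   \<union> {Foralls n (Imp (allV n) (Iff (Rn n (cst (Code n i))) (relV (E n i)))) | n i. True}
   \<union> {Foralls n (Neg (Rn n (cst (Code m i)))) | n m i. m \<noteq> n}
   \<union> {Foralls n (Imp (allV n) (Exists n (Conj (isN (Var n)) (Rn n (Var n))))) | n. True}"

definition hat_model ::
  "('f, 'r) voc \<Rightarrow> ('f, 'r) fm set \<Rightarrow> (nat \<Rightarrow> nat \<Rightarrow> ('f, 'r) fm)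
     \<Rightarrow> ('f sfun, 'r srel, 'u) str \<Rightarrow> bool" where
  "hat_model \<tau> T E M \<longleftrightarrow> is_sigma_str \<tau> M \<and> model_of (sigma \<tau>) (That T E) M"

definition constant_set :: "('f, 'r) voc \<Rightarrow> 'f sfun set \<Rightarrow> bool" where
  "constant_set \<tau> B \<longleftrightarrow> countable B \<and> consts_of (sigma \<tau>) \<subseteq> B \<and>
     B \<subseteq> consts_of (sigma \<tau>) \<union> range New"

definition sigma_ext :: "('f, 'r) voc \<Rightarrow> 'f sfun set \<Rightarrow> ('f sfun, 'r srel) voc" where
  "sigma_ext \<tau> B =
     \<lparr>Fsig = (\<lambda>c. if c \<in> B then Some 0 else Fsig (sigma \<tau>) c), Rsig = Rsig (sigma \<tau>)\<rparr>"

text \<open>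
  In \<open>\<psi>(x, v\<^sub>0, \<dots>, v\<^sub>n\<^sub>-\<^sub>1)\<close> the variable \<open>v\<^sub>i\<close> is \<open>Var i\<close> and
  \<open>x\<close> is \<open>Var n\<close>; \<open>psi_at \<psi> t ds\<close> is \<open>\<psi>(t, ds)\<close>.  The second premise of the
  rule says that \<open>\<psi>(x, v)\<close> defines a subset of \<open>N \<times> V\<^sup>n\<close>: with \<open>ds\<close> in place of the
  quantified \<open>v\<close> the quantifier would be detached from \<open>\<psi>\<close>.
\<close>

definition psi_at :: "('f, 'r) fm \<Rightarrow> 'f tm \<Rightarrow> 'f list \<Rightarrow> ('f, 'r) fm" where
  "psi_at \<psi> t ds =
     subst (\<lambda>i. if i < length ds then cst (ds ! i) else if i = length ds then t else Var i) \<psi>"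

definition G_omega_admissible ::
  "('f, 'r) voc \<Rightarrow> 'f sfun set \<Rightarrow> (('f sfun, 'r srel) fm \<Rightarrow> bool) \<Rightarrow> bool" where
  "G_omega_admissible \<tau> B v \<longleftrightarrow>
     (\<forall>n \<psi> ds. fm_in (sigma_ext \<tau> B) \<psi> \<and> fv \<psi> \<subseteq> {..n} \<and> set ds \<subseteq> B \<and> length ds = n \<longrightarrow>
        (\<forall>m i. v (psi_at \<psi> (cst (Code m i)) ds)) \<longrightarrow>
        v (Forall n (Foralls n (Imp \<psi> (Conj (isN (Var n)) (allV n))))) \<longrightarrow>
        v (Forall n (Imp (isN (Var n)) (psi_at \<psi> (Var n) ds))))"

definition forall_elim_admissible ::
  "('f, 'r) voc \<Rightarrow> 'f sfun set \<Rightarrow> (('f sfun, 'r srel) fm \<Rightarrow> bool) \<Rightarrow> bool" where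
  "forall_elim_admissible \<tau> B v \<longleftrightarrow>
     (\<forall>x \<psi>. \<forall>c \<in> B. Forall x \<psi> \<in> sentences (sigma_ext \<tau> B) \<longrightarrow>
        v (Forall x \<psi>) \<longrightarrow> v (subst (Var(x := cst c)) \<psi>))"

definition admissible_valuation ::
  "('f, 'r) voc \<Rightarrow> 'f sfun set \<Rightarrow> (('f sfun, 'r srel) fm \<Rightarrow> bool) \<Rightarrow> bool" where
  "admissible_valuation \<tau> B v \<longleftrightarrow> G_omega_admissible \<tau> B v \<and> forall_elim_admissible \<tau> B v"

text \<open>
  The valuation carried by a structure is truth in it.  Since the rule is about arbitrary
  countable sets \<open>B\<close> of constants, naming arbitrary elements, all expansions \<open>M'\<close> of \<open>M\<close>
  by constants from such sets are considered.  The supply \<open>New\<close> is infinite, so up to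
  renaming every countable set of additional constants occurs.
\<close>

definition satisfies_G_omega :: "('f, 'r) voc \<Rightarrow> ('f sfun, 'r srel, 'u) str \<Rightarrow> bool" where
  "satisfies_G_omega \<tau> M \<longleftrightarrow>
     (\<forall>B M'. constant_set \<tau> B \<and> is_str (sigma_ext \<tau> B) M' \<and> is_reduct (sigma \<tau>) M M' \<longrightarrow>
        admissible_valuation \<tau> B (true_in M'))"

end

theory Submission
  imports Defs
begin

text \<open>
  Applied to the formula saying that \<open>x\<close> is not \<open>R\<^sup>n\<close>-related to a tuple of \<open>V\<close>, the rule
  turns the covering axiom into the statement that some code is related to the tuple, that is,
  that the tuple satisfies a generator of a principal type.  Conversely, an atomic model becomes
  a model with the rule when an \<open>N\<close>-sort consisting of the codes only is added to it:
  atomicity is the covering axiom, and the rule holds since its premises run through all of \<open>N\<close>.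
  The ambient type is infinite, so it has room for a copy of the model next to the codes.
\<close>

section \<open>Coincidence and substitution\<close>

lemma tmval_cong:
  assumes "\<And>x. x \<in> tmvars t \<Longrightarrow> e x = e' x"
  shows "tmval M e t = tmval M e' t"
  using assms
proof (induction t)
  case (App f ts)
  then have "map (tmval M e) ts = map (tmval M e') ts"
    by (fastforce simp: map_eq_conv)
  then show ?case by (simp del: map_eq_conv)
qed simp

lemma sat_cong:
  assumes "\<And>x. x \<in> fv p \<Longrightarrow> e x = e' x"
  shows "sat M e p = sat M e' p"
  using assms
proof (induction p arbitrary: e e')
  case (Eq s t)
  then have "tmval M e s = tmval M e' s" "tmval M e t = tmval M e' t"
    by (auto intro!: tmval_cong)
  then show ?case by simp
next
  case (Rel r ts)
  then have "map (tmval M e) ts = map (tmval M e') ts"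
    by (auto intro!: tmval_cong)
  then show ?case by (simp del: map_eq_conv)
next
  case (Imp p q)
  have "sat M e p = sat M e' p" by (rule Imp.IH) (simp add: Imp.prems)
  moreover have "sat M e q = sat M e' q" by (rule Imp.IH) (simp add: Imp.prems)
  ultimately show ?case by simp
next
  case (Forall x p)
  have "sat M (e(x := a)) p = sat M (e'(x := a)) p" for a
    by (rule Forall.IH) (use Forall.prems in auto)
  then show ?case by simp
qed simp

lemma tmval_in_Dom:
  assumes "is_str \<tau> M" "tm_in \<tau> t" "range e \<subseteq> Dom M"
  shows "tmval M e t \<in> Dom M"
  using assms(2)
proof (induction t)
  case (App f ts)
  then have "map (tmval M e) ts \<in> tuples M (length ts)"
    by (auto simp: tuples_def list_all_iff)
  with App.prems assms(1) show ?case by (auto simp: is_str_def)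
qed (use assms in auto)

lemma tmval_tmsubst: "tmval M e (tmsubst s t) = tmval M (\<lambda>i. tmval M e (s i)) t"
proof (induction t)
  case (App f ts)
  then have "map (tmval M e) (map (tmsubst s) ts) = map (tmval M (\<lambda>i. tmval M e (s i))) ts"
    by simp
  then show ?case by (simp del: map_map map_eq_conv)
qed simp

text \<open>The side condition excludes capture.\<close>

lemma sat_subst:
  assumes "\<And>i. s i = Var i \<or> tmvars (s i) = {}"
  shows "sat M e (subst s p) = sat M (\<lambda>i. tmval M e (s i)) p"
  using assms
proof (induction p arbitrary: s e)
  case (Eq t u)
  then show ?case by (simp add: tmval_tmsubst)
next
  case (Rel r ts)
  have "map (tmval M e) (map (tmsubst s) ts) = map (tmval M (\<lambda>i. tmval M e (s i))) ts"
    by (simp add: tmval_tmsubst)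
  then show ?case by (simp del: map_map map_eq_conv)
next
  case (Imp p q)
  then show ?case by simp
next
  case (Forall x p)
  have "(\<lambda>i. tmval M (e(x := a)) ((s(x := Var x)) i)) = (\<lambda>i. tmval M e (s i))(x := a)" for a
  proof
    fix i
    have "tmval M (e(x := a)) (s i) = tmval M e (s i)" if "i \<noteq> x"
      using Forall.prems[of i] that by (auto intro!: tmval_cong)
    then show "tmval M (e(x := a)) ((s(x := Var x)) i) = ((\<lambda>i. tmval M e (s i))(x := a)) i"
      by simp
  qed
  moreover have "sat M (e(x := a)) (subst (s(x := Var x)) p) =
      sat M (\<lambda>i. tmval M (e(x := a)) ((s(x := Var x)) i)) p" for a
    by (rule Forall.IH) (use Forall.prems in auto)
  ultimately show ?case by simp
qed simp

text \<open>The two alternatives for \<open>t\<close> are its two uses in the rule: a constant in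
  the premises, and the variable x itself in the conclusion. Both meet the side condition of
  \<open>sat_subst\<close>.\<close>

lemma sat_psi_at:
  assumes "tmvars t = {} \<or> t = Var (length ds)"
  shows "sat M e (psi_at \<psi> t ds) = sat M (\<lambda>i. if i < length ds then Fn M (ds ! i) []
           else if i = length ds then tmval M e t else e i) \<psi>"
proof -
  have "(\<lambda>i. tmval M e (if i < length ds then cst (ds ! i) else if i = length ds then t else Var i))
      = (\<lambda>i. if i < length ds then Fn M (ds ! i) []
           else if i = length ds then tmval M e t else e i)"
    by auto
  with assms show ?thesis
    unfolding psi_at_def by (subst sat_subst) auto
qed

section \<open>Finite conjunctions and blocks of universal quantifiers\<close>

lemma sat_BigConj: "sat M e (BigConj n F) \<longleftrightarrow> (\<forall>i<n. sat M e (F i))"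
  by (induction n) (auto simp: less_Suc_eq)

lemma fm_in_BigConj: "fm_in \<tau> (BigConj n F) \<longleftrightarrow> (\<forall>i<n. fm_in \<tau> (F i))"
  by (induction n) (auto simp: less_Suc_eq)

lemma fv_BigConj: "fv (BigConj n F) = (\<Union>i<n. fv (F i))"
  by (induction n) (auto simp: lessThan_Suc)

text \<open>\<open>Foralls\<close> attaches the quantifier with the largest index directly to the
  matrix, so the matrix changes along the induction and has to be arbitrary.\<close>

lemma sat_Foralls:
  "sat M e (Foralls n p) \<longleftrightarrow>
     (\<forall>e'. (\<forall>i<n. e' i \<in> Dom M) \<and> (\<forall>i\<ge>n. e' i = e i) \<longrightarrow> sat M e' p)"
proof (induction n arbitrary: p)
  case 0
  have "e' = e" if "\<forall>i. e' i = e i" for e' using that by auto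
  then show ?case by auto
next
  case (Suc n)
  show ?case unfolding Foralls.simps Suc
  proof safe
    fix e'
    assume *: "\<forall>e'. (\<forall>i<n. e' i \<in> Dom M) \<and> (\<forall>i\<ge>n. e' i = e i) \<longrightarrow> sat M e' (Forall n p)"
      "\<forall>i<Suc n. e' i \<in> Dom M" "\<forall>i\<ge>Suc n. e' i = e i"
    \<comment> \<open>The assumption speaks of assignments equal to \<open>e\<close> from
      \<open>n\<close> on, whereas \<open>e'\<close> is known to agree with \<open>e\<close> only
      above \<open>n\<close>. So the value at \<open>n\<close> is reset first, and the innermost
      quantifier restores it.\<close>
    have "sat M (e'(n := e n)) (Forall n p)"
      using * by (metis fun_upd_apply le_antisym less_SucI not_less_eq_eq order.strict_iff_not)
    moreover have "e' n \<in> Dom M" using *(2) by simp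
    ultimately have "sat M ((e'(n := e n))(n := e' n)) p" unfolding sat.simps by (rule bspec)
    then show "sat M e' p" by simp
  next
    fix e'
    assume *: "\<forall>e'. (\<forall>i<Suc n. e' i \<in> Dom M) \<and> (\<forall>i\<ge>Suc n. e' i = e i) \<longrightarrow> sat M e' p"
      "\<forall>i<n. e' i \<in> Dom M" "\<forall>i\<ge>n. e' i = e i"
    then show "sat M e' (Forall n p)" by (auto simp: less_Suc_eq)
  qed
qed

text \<open>\<open>true_in\<close> already ranges over all assignments into the domain, and changing
  some values within the domain gives another such assignment. This reduces the axioms in
  \<open>That\<close> to their matrices.\<close>

lemma true_in_Foralls: "true_in M (Foralls n p) \<longleftrightarrow> true_in M p"
proof
  assume *: "true_in M (Foralls n p)"
  show "true_in M p" unfolding true_in_def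
  proof safe
    fix e :: "nat \<Rightarrow> _" assume e: "range e \<subseteq> Dom M"
    with * have "sat M e (Foralls n p)" by (auto simp: true_in_def)
    then have "(\<forall>i<n. e i \<in> Dom M) \<and> (\<forall>i\<ge>n. e i = e i) \<longrightarrow> sat M e p"
      unfolding sat_Foralls by (rule spec)
    then show "sat M e p" using e by (simp add: range_subsetD)
  qed
next
  assume *: "true_in M p"
  show "true_in M (Foralls n p)" unfolding true_in_def
  proof safe
    fix e :: "nat \<Rightarrow> _" assume e: "range e \<subseteq> Dom M"
    show "sat M e (Foralls n p)" unfolding sat_Foralls
    proof safe
      fix e' assume e': "\<forall>i<n. e' i \<in> Dom M" "\<forall>i\<ge>n. e' i = e i"
      have "range e' \<subseteq> Dom M"
      proof (rule image_subsetI)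
        fix i
        show "e' i \<in> Dom M"
        proof (cases "i < n")
          case False
          then have "e' i = e i" using e'(2) by simp
          then show ?thesis using e by (simp add: range_subsetD)
        qed (simp add: e'(1))
      qed
      with * show "sat M e' p" by (simp add: true_in_def)
    qed
  qed
qed

lemma true_in_ForallsD:
  assumes "true_in M (Foralls n p)" "range e \<subseteq> Dom M"
  shows "sat M e p"
  using assms unfolding true_in_Foralls by (simp add: true_in_def)

section \<open>Relativization to the sort V\<close>

lemma tmval_map_tm: "tmval M e (map_tm TauF t) = tmval (Vpart M) e t"
proof (induction t)
  case (App f ts)
  then have "map (tmval M e) (map (map_tm TauF) ts) = map (tmval (Vpart M) e) ts" by simp
  then show ?case by (simp add: Vpart_def del: map_map map_eq_conv)
qed simp

text \<open>\<open>Vpart\<close> keeps functions and relations on all arguments and only shrinks the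
  domain, exactly as \<open>relV\<close> bounds the quantifiers. Hence the values of
  \<open>e\<close> may lie outside V, as default values below may do.\<close>

lemma sat_relV: "sat M e (relV p) = sat (Vpart M) e p"
proof (induction p arbitrary: e)
  case (Rel r ts)
  have "map (tmval M e) (map (map_tm TauF) ts) = map (tmval (Vpart M) e) ts"
    by (simp add: tmval_map_tm)
  then show ?case by (simp add: Vpart_def del: map_map map_eq_conv)
next
  case (Forall x p)
  have Dom: "a \<in> Dom (Vpart M) \<longleftrightarrow> a \<in> Dom M \<and> Rl M SortV [a]" for a
    by (simp add: Vpart_def inV_def)
  have "sat M e (relV (Forall x p)) \<longleftrightarrow> (\<forall>a\<in>Dom M. Rl M SortV [a] \<longrightarrow> sat M (e(x := a)) (relV p))"
    by simp
  then show ?case unfolding Forall sat.simps using Dom by blast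
qed (simp_all add: tmval_map_tm)

section \<open>Invariance under isomorphism, first-order and infinitary\<close>

text \<open>Keeps the isomorphism \<open>h\<close> in view, since assignments have to be carried
  along it.\<close>

definition iso_by ::
  "('f, 'r) voc \<Rightarrow> ('u \<Rightarrow> 'w) \<Rightarrow> ('f, 'r, 'u) str \<Rightarrow> ('f, 'r, 'w) str \<Rightarrow> bool" where
  "iso_by \<tau> h M M' \<longleftrightarrow> bij_betw h (Dom M) (Dom M') \<and>
     (\<forall>f k. Fsig \<tau> f = Some k \<longrightarrow> (\<forall>as \<in> tuples M k. h (Fn M f as) = Fn M' f (map h as))) \<and>
     (\<forall>r k. Rsig \<tau> r = Some k \<longrightarrow> (\<forall>as \<in> tuples M k. Rl M r as = Rl M' r (map h as)))"

lemma iso_str_iff: "iso_str \<tau> M M' \<longleftrightarrow> (\<exists>h. iso_by \<tau> h M M')"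
  by (simp add: iso_str_def iso_by_def)

lemma tmval_iso:
  assumes "iso_by \<tau> h M M'" "is_str \<tau> M" "tm_in \<tau> t" "range e \<subseteq> Dom M"
  shows "tmval M' (h \<circ> e) t = h (tmval M e t)"
  using assms(3)
proof (induction t)
  case (App f ts)
  then have "map (tmval M e) ts \<in> tuples M (length ts)"
    using assms by (auto simp: tuples_def list_all_iff intro!: tmval_in_Dom)
  then have "h (Fn M f (map (tmval M e) ts)) = Fn M' f (map h (map (tmval M e) ts))"
    using assms(1) App.prems by (auto simp: iso_by_def simp del: map_map)
  moreover have "map h (map (tmval M e) ts) = map (tmval M' (h \<circ> e)) ts"
  proof -
    have "h (tmval M e t) = tmval M' (h \<circ> e) t" if "t \<in> set ts" for t
      using App.IH[OF that] App.prems that by (simp add: list_all_iff comp_def)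
    then show ?thesis unfolding map_map map_eq_conv comp_apply by blast
  qed
  ultimately show ?case by (simp add: comp_def del: map_map)
qed simp

lemma Eq_iso:
  assumes "iso_by \<tau> h M M'" "is_str \<tau> M" "tm_in \<tau> s" "tm_in \<tau> t" "range e \<subseteq> Dom M"
  shows "tmval M' (h \<circ> e) s = tmval M' (h \<circ> e) t \<longleftrightarrow> tmval M e s = tmval M e t"
proof -
  have "inj_on h (Dom M)" using assms(1) by (auto simp: iso_by_def bij_betw_def)
  with assms show ?thesis
    by (simp add: tmval_iso[OF assms(1)] inj_on_eq_iff tmval_in_Dom[OF assms(2)])
qed

lemma Rel_iso:
  assumes "iso_by \<tau> h M M'" "is_str \<tau> M" "Rsig \<tau> r = Some (length ts)"
    "list_all (tm_in \<tau>) ts" "range e \<subseteq> Dom M"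
  shows "Rl M' r (map (tmval M' (h \<circ> e)) ts) = Rl M r (map (tmval M e) ts)"
proof -
  have "map (tmval M e) ts \<in> tuples M (length ts)"
    using assms by (auto simp: tuples_def list_all_iff intro!: tmval_in_Dom)
  then have "Rl M r (map (tmval M e) ts) = Rl M' r (map h (map (tmval M e) ts))"
    using assms(1,3) by (auto simp: iso_by_def simp del: map_map)
  moreover have "map h (map (tmval M e) ts) = map (tmval M' (h \<circ> e)) ts"
    using assms by (auto simp: list_all_iff tmval_iso[OF assms(1,2)])
  ultimately show ?thesis by (simp del: map_map)
qed

text \<open>The quantifier case common to \<open>sat_iso\<close> and \<open>isat_iso\<close>, with
  \<open>P\<close> and \<open>Q\<close> standing for satisfaction of the body. It rests on
  \<open>h\<close> being onto.\<close>

lemma ball_Dom_iso: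
  assumes "iso_by \<tau> h M M'" "range e \<subseteq> Dom M"
    "\<And>e. range e \<subseteq> Dom M \<Longrightarrow> P (h \<circ> e) = Q e"
  shows "(\<forall>a\<in>Dom M'. P ((h \<circ> e)(x := a))) \<longleftrightarrow> (\<forall>a\<in>Dom M. Q (e(x := a)))"
proof -
  have "Dom M' = h ` Dom M" using assms(1) by (auto simp: iso_by_def bij_betw_def)
  moreover have "P ((h \<circ> e)(x := h a)) = Q (e(x := a))" if "a \<in> Dom M" for a
  proof -
    have "range (e(x := a)) \<subseteq> Dom M" using that assms(2) by auto
    moreover have "h \<circ> e(x := a) = (h \<circ> e)(x := h a)" by auto
    ultimately show ?thesis using assms(3)[of "e(x := a)"] by simp
  qed
  ultimately show ?thesis by auto
qed

lemma sat_iso: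
  assumes "iso_by \<tau> h M M'" "is_str \<tau> M" "fm_in \<tau> p" "range e \<subseteq> Dom M"
  shows "sat M' (h \<circ> e) p = sat M e p"
  using assms(3,4)
proof (induction p arbitrary: e)
  case (Eq s t)
  then show ?case unfolding sat.simps by (intro Eq_iso[OF assms(1,2)]) simp_all
next
  case (Rel r ts)
  then show ?case unfolding sat.simps by (intro Rel_iso[OF assms(1,2)]) simp_all
next
  case (Forall x p)
  then show ?case unfolding sat.simps
    by (intro ball_Dom_iso[OF assms(1), where P="\<lambda>e. sat M' e p" and Q="\<lambda>e. sat M e p"]) (simp_all add: comp_def)
qed simp_all

lemma isat_iso:
  assumes "iso_by \<tau> h M M'" "is_str \<tau> M" "ifm_in \<tau> p" "range e \<subseteq> Dom M"
  shows "isat M' (h \<circ> e) p = isat M e p"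
  using assms(3,4)
proof (induction p arbitrary: e)
  case (IEq s t)
  then show ?case unfolding isat.simps by (intro Eq_iso[OF assms(1,2)]) simp_all
next
  case (IRel r ts)
  then show ?case unfolding isat.simps by (intro Rel_iso[OF assms(1,2)]) simp_all
next
  case (IForall x p)
  then show ?case unfolding isat.simps
    by (intro ball_Dom_iso[OF assms(1), where P="\<lambda>e. isat M' e p" and Q="\<lambda>e. isat M e p"]) (simp_all add: comp_def)
qed simp_all

lemma imodel_of_iso:
  assumes "iso_by \<tau> h M M'" "is_str \<tau> M" "ifm_in \<tau> p" "imodel_of \<tau> p M'"
  shows "imodel_of \<tau> p M"
  unfolding imodel_of_def
proof (intro conjI allI impI)
  fix e :: "nat \<Rightarrow> _" assume e: "range e \<subseteq> Dom M"
  then have "range (h \<circ> e) \<subseteq> Dom M'"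
    using assms(1) by (auto simp: iso_by_def bij_betw_def)
  with assms(4) have "isat M' (h \<circ> e) p" by (auto simp: imodel_of_def)
  with e assms show "isat M e p" by (simp add: isat_iso)
qed (use assms in simp)

lemma true_in_iso:
  assumes "iso_by \<tau> h M M'" "is_str \<tau> M" "fm_in \<tau> p" "true_in M p"
  shows "true_in M' p"
  unfolding true_in_def
proof (intro allI impI)
  fix e :: "nat \<Rightarrow> _" assume e: "range e \<subseteq> Dom M'"
  have h: "bij_betw h (Dom M) (Dom M')" using assms(1) by (simp add: iso_by_def)
  define e' where "e' = inv_into (Dom M) h \<circ> e"
  have "range e' \<subseteq> Dom M"
    using e h by (auto simp: e'_def bij_betw_def inv_into_into subset_iff image_subset_iff)
  moreover have "h \<circ> e' = e"
    using e h by (auto simp: e'_def bij_betw_def f_inv_into_f subset_iff)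
  ultimately show "sat M' e p" using sat_iso[OF assms(1-3), of e'] assms(4)
    unfolding true_in_def by metis
qed

section \<open>Principal types and their generators\<close>

text \<open>\<open>nth as\<close> is unspecified beyond the length of \<open>as\<close>, hence the hypothesis on free variables.\<close>

lemma true_in_sat_nth:
  assumes "true_in M p" "Dom M \<noteq> {}" "as \<in> tuples M n" "fv p \<subseteq> {..<n}"
  shows "sat M (nth as) p"
proof -
  obtain a where a: "a \<in> Dom M" using assms(2) by auto
  define e where "e = (\<lambda>i. if i < n then as ! i else a)"
  have "range e \<subseteq> Dom M" using a assms(3) by (auto simp: e_def tuples_def subset_iff)
  with assms(1) have "sat M e p" by (auto simp: true_in_def)
  also have "sat M e p = sat M (nth as) p"
    using assms(4) by (intro sat_cong) (auto simp: e_def)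
  finally show ?thesis .
qed

text \<open>A complete type generated by \<open>\<theta>\<close> is the only one containing
  \<open>\<theta>\<close>: it decides every formula in its variables, and \<open>\<theta>\<close>
  entails each decision, so a tuple satisfying \<open>\<theta>\<close> can realize no other
  type.\<close>

lemma generates_tp:
  fixes M :: "('f, 'r, 'u) str"
  assumes M: "model_of \<tau> T M" "as \<in> tuples M n"
    and p: "complete_type TYPE('u) \<tau> T n p" "generates TYPE('u) \<tau> T \<theta> p"
    and sat: "sat M (nth as) \<theta>"
  shows "generates TYPE('u) \<tau> T \<theta> (tp \<tau> M as)"
proof -
  obtain K :: "('f, 'r, 'u) str" and bs where K: "bs \<in> tuples K n" "p = tp \<tau> K bs"
    using p(1) unfolding complete_type_def by blast
  then have p_iff: "\<chi> \<in> p \<longleftrightarrow> fm_in \<tau> \<chi> \<and> fv \<chi> \<subseteq> {..<n} \<and> sat K (nth bs) \<chi>" for \<chi>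
    by (simp add: tp_def tuples_def)
  have tp_iff: "\<chi> \<in> tp \<tau> M as \<longleftrightarrow> fm_in \<tau> \<chi> \<and> fv \<chi> \<subseteq> {..<n} \<and> sat M (nth as) \<chi>" for \<chi>
    using M(2) by (simp add: tp_def tuples_def)
  have \<theta>: "\<theta> \<in> p" and ent: "\<And>\<chi>. \<chi> \<in> p \<Longrightarrow> entails TYPE('u) \<tau> T (Imp \<theta> \<chi>)"
    using p(2) unfolding generates_def by blast+
  have "Dom M \<noteq> {}" using M(1) by (simp add: model_of_def is_str_def)
  have "\<chi> \<in> p" if \<chi>: "\<chi> \<in> tp \<tau> M as" for \<chi>
  proof (rule ccontr)
    assume "\<chi> \<notin> p"
    \<comment> \<open>Being the type of \<open>bs\<close> in \<open>K\<close>, \<open>p\<close>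
      contains the negation of every formula in its variables that it omits.\<close>
    then have "Neg \<chi> \<in> p" using \<chi> by (simp add: p_iff tp_iff)
    then have "true_in M (Imp \<theta> (Neg \<chi>))"
      using ent M(1) unfolding entails_def by blast
    moreover have "fv (Imp \<theta> (Neg \<chi>)) \<subseteq> {..<n}"
      using \<theta> \<chi> by (simp add: p_iff tp_iff)
    ultimately have "sat M (nth as) (Imp \<theta> (Neg \<chi>))"
      using \<open>Dom M \<noteq> {}\<close> M(2) by (intro true_in_sat_nth)
    then show False using sat \<chi> by (simp add: tp_iff)
  qed
  moreover have "\<theta> \<in> tp \<tau> M as" using \<theta> sat by (simp add: p_iff tp_iff)
  ultimately show ?thesis using ent unfolding generates_def by blast
qed

text \<open>This makes atomicity a matter of satisfying listed formulas. For the converse,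
  \<open>E n i\<close> generates some complete type, hence by \<open>generates_tp\<close> the type
  of any tuple satisfying it.\<close>

lemma principal_tp_iff:
  fixes M :: "('f, 'r, 'u) str"
  assumes "enumerates_principal_types TYPE('u) \<tau> T E" "model_of \<tau> T M" "as \<in> tuples M n"
  shows "principal TYPE('u) \<tau> T (tp \<tau> M as) \<longleftrightarrow> (\<exists>i. sat M (nth as) (E n i))"
proof
  assume "principal TYPE('u) \<tau> T (tp \<tau> M as)"
  moreover have "complete_type TYPE('u) \<tau> T n (tp \<tau> M as)"
    using assms by (auto simp: complete_type_def)
  ultimately obtain i where "generates TYPE('u) \<tau> T (E n i) (tp \<tau> M as)"
    using assms(1) unfolding enumerates_principal_types_def by metis
  then show "\<exists>i. sat M (nth as) (E n i)" by (auto simp: generates_def tp_def)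
next
  assume "\<exists>i. sat M (nth as) (E n i)"
  then obtain i where i: "sat M (nth as) (E n i)" by blast
  obtain p where "complete_type TYPE('u) \<tau> T n p" "generates TYPE('u) \<tau> T (E n i) p"
    using assms(1) unfolding enumerates_principal_types_def by metis
  then have "generates TYPE('u) \<tau> T (E n i) (tp \<tau> M as)"
    using i by (rule generates_tp[OF assms(2,3)])
  then show "principal TYPE('u) \<tau> T (tp \<tau> M as)" by (auto simp: principal_def)
qed

text \<open>A generator belongs to its type, and types contain only formulas of the vocabulary in
  the right variables.\<close>

lemma E_wf:
  assumes "enumerates_principal_types TYPE('u) \<tau> T E"
  shows "fm_in \<tau> (E n i)" "fv (E n i) \<subseteq> {..<n}"
proof -
  obtain p where "complete_type TYPE('u) \<tau> T n p" "generates TYPE('u) \<tau> T (E n i) p"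
    using assms unfolding enumerates_principal_types_def by metis
  then show "fm_in \<tau> (E n i)" "fv (E n i) \<subseteq> {..<n}"
    by (auto simp: complete_type_def generates_def tp_def tuples_def)
qed

section \<open>The sort V of a model of \<open>That\<close>\<close>

lemma is_str_Vpart:
  assumes "is_sigma_str \<tau> B"
  shows "is_str \<tau> (Vpart B)"
  unfolding is_str_def
proof (intro conjI allI impI ballI)
  show "Dom (Vpart B) \<noteq> {}" using assms by (auto simp: is_sigma_str_def Vpart_def)
next
  fix f k as assume *: "Fsig \<tau> f = Some k" "as \<in> tuples (Vpart B) k"
  then have "as \<in> tuples B k" "set as \<subseteq> inV B"
    by (auto simp: tuples_def Vpart_def inV_def)
  with * assms show "Fn (Vpart B) f as \<in> Dom (Vpart B)"
    by (auto simp: is_sigma_str_def Vpart_def)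
qed

lemma true_in_relV:
  assumes "inV B \<noteq> {}" "fv p = {}"
  shows "true_in B (relV p) \<longleftrightarrow> true_in (Vpart B) p"
proof -
  obtain a where a: "a \<in> inV B" using assms by auto
  define P where "P \<longleftrightarrow> sat (Vpart B) (\<lambda>_. a) p"
  have P: "sat (Vpart B) e p \<longleftrightarrow> P" for e
    unfolding P_def by (rule sat_cong) (simp add: assms(2))
  have "range (\<lambda>_ :: nat. a) \<subseteq> Dom (Vpart B)" "range (\<lambda>_ :: nat. a) \<subseteq> Dom B"
    using a by (auto simp: Vpart_def inV_def)
  then show ?thesis unfolding true_in_def sat_relV P by blast
qed

lemma That_intros:
  shows "p \<in> T \<Longrightarrow> relV p \<in> That T E"
    and "isN (cst (Code n i)) \<in> That T E"
    and "Foralls n (Imp (allV n) (Iff (Rn n (cst (Code n i))) (relV (E n i)))) \<in> That T E"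
    and "m \<noteq> n \<Longrightarrow> Foralls n (Neg (Rn n (cst (Code m i)))) \<in> That T E"
    and "Foralls n (Imp (allV n) (Exists n (Conj (isN (Var n)) (Rn n (Var n))))) \<in> That T E"
  unfolding That_def
  subgoal by (intro UnI1 imageI)
  subgoal by (rule UnI1, rule UnI1, rule UnI1, rule UnI2,
      rule CollectI, (rule exI)+, rule conjI, rule refl, rule TrueI)
  subgoal by (rule UnI1, rule UnI1, rule UnI2,
      rule CollectI, (rule exI)+, rule conjI, rule refl, rule TrueI)
  subgoal by (rule UnI1, rule UnI2,
      rule CollectI, (rule exI)+, rule conjI, rule refl)
  subgoal by (rule UnI2,
      rule CollectI, (rule exI)+, rule conjI, rule refl, rule TrueI)
  done

lemma model_of_Vpart:
  assumes "T \<subseteq> sentences \<tau>" "hat_model \<tau> T E B"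
  shows "model_of \<tau> T (Vpart B)"
  unfolding model_of_def
proof (intro conjI ballI)
  show "is_str \<tau> (Vpart B)" using assms is_str_Vpart by (auto simp: hat_model_def)
next
  fix p assume "p \<in> T"
  then have "true_in B (relV p)" "fv p = {}"
    using assms That_intros(1)[of p T E] by (auto simp: hat_model_def model_of_def sentences_def)
  moreover have "inV B \<noteq> {}" using assms by (auto simp: hat_model_def is_sigma_str_def)
  ultimately show "true_in (Vpart B) p" by (simp add: true_in_relV)
qed

section \<open>The rule forces atomicity\<close>

text \<open>
  The rule is applied to \<open>N(x) \<and> V(v) \<and> \<not> R\<^sup>n(x, v)\<close>: if no enumerated formula
  held of \<open>as\<close>, then no element of \<open>N\<close> would be related to \<open>as\<close>.
\<close>

lemma G_omega_covering:
  assumes countable: "countable_voc \<tau>"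
    and hat: "hat_model \<tau> T E B" and rule: "satisfies_G_omega \<tau> B"
    and as: "as \<in> tuples (Vpart B) n"
    and fv_E: "\<And>i. fv (E n i) \<subseteq> {..<n}"
  shows "\<exists>i. sat (Vpart B) (nth as) (E n i)"
proof (rule ccontr)
  assume neg: "\<nexists>i. sat (Vpart B) (nth as) (E n i)"
  have len: "length as = n" and as_V: "\<And>i. i < n \<Longrightarrow> as ! i \<in> inV B"
    using as by (auto simp: tuples_def Vpart_def subset_iff)
  then have as_Dom: "\<And>i. i < n \<Longrightarrow> as ! i \<in> Dom B" by (auto simp: inV_def)
  have str: "is_sigma_str \<tau> B" and ax: "\<And>p. p \<in> That T E \<Longrightarrow> true_in B p"
    using hat by (auto simp: hat_model_def model_of_def)
  have Bstr: "is_str (sigma \<tau>) B" using str by (simp add: is_sigma_str_def)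
  obtain a0 where a0: "a0 \<in> Dom B" using Bstr by (auto simp: is_str_def)
  have code_Dom: "Fn B (Code m i) [] \<in> Dom B" for m i
    using Bstr by (auto simp: is_str_def sigma_def tuples_def)
  \<comment> \<open>From \<open>n\<close> on, \<open>e0\<close> takes the default \<open>a0\<close>,
    which only has to keep it inside the domain.\<close>
  define e0 where "e0 = (\<lambda>i. if i < n then as ! i else a0)"
  have e0: "range e0 \<subseteq> Dom B" using a0 as_Dom by (auto simp: e0_def)
  have args: "map (tmval B e0) (map Var [0..<n]) = as"
    using len by (auto simp: e0_def intro!: nth_equalityI)
  have code_N: "Rl B SortN [Fn B (Code m i) []]" for m i
    using ax[OF That_intros(2), of m i] e0 by (auto simp: true_in_def)
  have sat_V: "sat B e0 (allV n)"
    using as_V by (simp add: sat_BigConj e0_def inV_def)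
  \<comment> \<open>For \<open>m = n\<close> the axiom tying R^n to \<open>E n i\<close> reduces
    this to \<open>neg\<close>; for other \<open>m\<close> it is one of the axioms denying R^n of
    codes with a different first index.\<close>
  have code_R: "\<not> Rl B (RN n) (Fn B (Code m i) [] # as)" for m i
  proof (cases "m = n")
    case True
    have "sat B e0 (Imp (allV n) (Iff (Rn n (cst (Code n i))) (relV (E n i))))"
      by (rule true_in_ForallsD[OF ax[OF That_intros(3)] e0])
    then have "sat B e0 (Rn n (cst (Code n i))) \<longleftrightarrow> sat B e0 (relV (E n i))"
      using sat_V unfolding sat.simps(1,4) by satx
    moreover have "sat B e0 (relV (E n i)) = sat (Vpart B) (nth as) (E n i)"
      unfolding sat_relV
    proof (rule sat_cong)
      fix j assume "j \<in> fv (E n i)"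
      then show "e0 j = as ! j" using fv_E[of i] by (auto simp: e0_def)
    qed
    moreover have "\<not> sat (Vpart B) (nth as) (E n i)" using neg by simp
    ultimately have "\<not> sat B e0 (Rn n (cst (Code n i)))" by simp
    then show ?thesis using args True by simp
  next
    case False
    have "sat B e0 (Neg (Rn n (cst (Code m i))))"
      by (rule true_in_ForallsD[OF ax[OF That_intros(4)[OF False]] e0])
    then show ?thesis using args by simp
  qed
  \<comment> \<open>The covering axiom supplies an element \<open>w\<close> of N related to
    \<open>as\<close>, which the conclusion of the rule will contradict.\<close>
  have "sat B e0 (Imp (allV n) (Exists n (Conj (isN (Var n)) (Rn n (Var n)))))"
    by (rule true_in_ForallsD[OF ax[OF That_intros(5)] e0])
  then obtain w where w: "w \<in> Dom B" "sat B (e0(n := w)) (isN (Var n))"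
      "sat B (e0(n := w)) (Rn n (Var n))"
    using sat_V unfolding sat.simps(1,4,5) by blast
  have "map (tmval B (e0(n := w))) (map Var [0..<n]) = as"
    using len by (simp add: e0_def list_eq_iff_nth_eq)
  then have wN: "Rl B SortN [w]" and wR: "Rl B (RN n) (w # as)" using w(2,3) by simp_all

  \<comment> \<open>The parameters of the rule are constants, so the entries of \<open>as\<close>
    receive fresh names. The expansion \<open>B'\<close> interprets \<open>New k\<close> by
    \<open>e0 k\<close>, which lies in the domain for every \<open>k\<close>.\<close>
  define C where "C = consts_of (sigma \<tau>) \<union> New ` {..<n}"
  define ds :: "'a sfun list" where "ds = map New [0..<n]"
  define B' where "B' = B\<lparr>Fn := (\<lambda>f xs. case f of New k \<Rightarrow> e0 k | _ \<Rightarrow> Fn B f xs)\<rparr>"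
  have [simp]: "Dom B' = Dom B" "Rl B' = Rl B" "Fn B' (New k) xs = e0 k"
    "Fn B' (Code m i) xs = Fn B (Code m i) xs" "Fn B' (TauF f) xs = Fn B (TauF f) xs" for k m i xs f
    by (simp_all add: B'_def)
  define \<psi> :: "('a sfun, 'b srel) fm" where
    "\<psi> = Conj (isN (Var n)) (Conj (allV n) (Neg (Rn n (Var n))))"
  have "consts_of (sigma \<tau>) \<subseteq> TauF ` dom (Fsig \<tau>) \<union> range (case_prod Code)"
  proof
    fix c assume "c \<in> consts_of (sigma \<tau>)"
    then show "c \<in> TauF ` dom (Fsig \<tau>) \<union> range (case_prod Code)"
      by (cases c) (auto simp: consts_of_def sigma_def image_iff)
  qed
  moreover have "countable (TauF ` dom (Fsig \<tau>) \<union> range (case_prod Code))"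
    using countable by (auto simp: countable_voc_def)
  ultimately have "countable (consts_of (sigma \<tau>))" by (rule countable_subset)
  then have C: "constant_set \<tau> C" by (auto simp: constant_set_def C_def)
  \<comment> \<open>Adding \<open>C\<close> changes the arity of no old symbol: members of
    \<open>C\<close> other than the \<open>New k\<close> are constants already.\<close>
  have Fn_Dom: "Fn B' f xs \<in> Dom B'"
    if "Fsig (sigma_ext \<tau> C) f = Some k" "xs \<in> tuples B' k" for f k xs
  proof (cases f)
    case (TauF g)
    then have "Fsig (sigma \<tau>) f = Some k"
      using that by (auto simp: sigma_ext_def C_def consts_of_def split: if_splits)
    with that TauF Bstr show ?thesis by (auto simp: is_str_def tuples_def)
  next
    case (Code m i)
    then have "Fsig (sigma \<tau>) f = Some k"
      using that by (auto simp: sigma_ext_def C_def consts_of_def split: if_splits)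
    with that Code Bstr show ?thesis by (auto simp: is_str_def tuples_def)
  next
    case (New j)
    then show ?thesis using e0 by auto
  qed
  have "is_str (sigma_ext \<tau> C) B'" using Fn_Dom a0 by (auto simp: is_str_def)
  moreover have "is_reduct (sigma \<tau>) B B'"
    unfolding is_reduct_def
  proof (intro conjI allI impI ballI)
    fix f k xs assume "Fsig (sigma \<tau>) f = Some k"
    then show "Fn B f xs = Fn B' f xs" by (cases f) (auto simp: sigma_def)
  qed simp_all
  ultimately have adm: "G_omega_admissible \<tau> C (true_in B')"
    using rule C by (auto simp: satisfies_G_omega_def admissible_valuation_def)
  have Rsig: "Rsig (sigma_ext \<tau> C) = sigma_rar \<tau>" by (simp add: sigma_ext_def sigma_def)
  have wf: "fm_in (sigma_ext \<tau> C) \<psi>" "fv \<psi> \<subseteq> {..n}"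
    unfolding \<psi>_def by (auto simp: Rsig fm_in_BigConj fv_BigConj list_all_iff)
  have ds: "set ds \<subseteq> C" "length ds = n" by (auto simp: ds_def C_def)
  have sat_\<psi>: "sat B' e \<psi> \<longleftrightarrow>
      Rl B SortN [e n] \<and> (\<forall>i<n. Rl B SortV [e i]) \<and> \<not> Rl B (RN n) (e n # map e [0..<n])" for e
    by (auto simp: \<psi>_def sat_BigConj comp_def)
  \<comment> \<open>Substituting \<open>ds\<close> puts the entries of \<open>as\<close> at the
    first \<open>n\<close> variables, so the conjunct \<open>allV n\<close> holds and drops
    out.\<close>
  have sat_at: "sat B' e (psi_at \<psi> t ds) \<longleftrightarrow>
      Rl B SortN [tmval B' e t] \<and> \<not> Rl B (RN n) (tmval B' e t # as)"
    if "tmvars t = {} \<or> t = Var n" for e t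
  proof -
    define e1 where "e1 = (\<lambda>i. if i < length ds then Fn B' (ds ! i) []
        else if i = length ds then tmval B' e t else e i)"
    have e1: "e1 i = e0 i" if "i < n" for i using that by (simp add: e1_def ds_def)
    have "e1 n = tmval B' e t" by (simp add: e1_def ds_def)
    moreover have "map e1 [0..<n] = as"
      using len by (simp add: list_eq_iff_nth_eq e1) (simp add: e0_def)
    moreover have "\<forall>i<n. Rl B SortV [e1 i]"
      using as_V by (simp add: e1) (simp add: e0_def inV_def)
    moreover have "sat B' e (psi_at \<psi> t ds) = sat B' e1 \<psi>"
      unfolding e1_def using that ds(2) by (intro sat_psi_at) simp
    ultimately show ?thesis by (simp add: sat_\<psi>)
  qed
  have "true_in B' (psi_at \<psi> (cst (Code m i)) ds)" for m i
    using code_N code_R by (auto simp: true_in_def sat_at)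
  \<comment> \<open>The conjuncts \<open>isN\<close> and \<open>allV\<close> of
    \<open>\<psi>\<close> make this premise true by its form.\<close>
  moreover have "true_in B' (Forall n (Foralls n (Imp \<psi> (Conj (isN (Var n)) (allV n)))))"
    by (simp add: true_in_def sat_Foralls sat_\<psi> sat_BigConj)
  ultimately have "true_in B' (Forall n (Imp (isN (Var n)) (psi_at \<psi> (Var n) ds)))"
    using adm wf ds unfolding G_omega_admissible_def by blast
  then have "sat B' e0 (Forall n (Imp (isN (Var n)) (psi_at \<psi> (Var n) ds)))"
    using e0 by (auto simp: true_in_def)
  then have "sat B' (e0(n := w)) (Imp (isN (Var n)) (psi_at \<psi> (Var n) ds))"
    using w(1) by simp
  then show False using wN wR by (simp add: sat_at)
qed

lemma atomic_model_Vpart: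
  fixes B :: "('f sfun, 'r srel, 'u) str"
  assumes "countable_voc \<tau>" "T \<subseteq> sentences \<tau>"
    and enum: "enumerates_principal_types TYPE('u) \<tau> T E"
    and B: "hat_model \<tau> T E B" "satisfies_G_omega \<tau> B"
  shows "atomic_model \<tau> T (Vpart B)"
  unfolding atomic_model_def
proof (intro conjI allI ballI)
  show model: "model_of \<tau> T (Vpart B)" using assms(2) B(1) by (rule model_of_Vpart)
  fix n as assume as: "as \<in> tuples (Vpart B) n"
  have "\<exists>i. sat (Vpart B) (nth as) (E n i)"
    using assms(1) B as E_wf(2)[OF enum] by (rule G_omega_covering)
  then show "principal TYPE('u) \<tau> T (tp \<tau> (Vpart B) as)"
    using principal_tp_iff[OF enum model as] by blast
qed

section \<open>From an atomic model to a model of \<open>That\<close> with the rule\<close>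

text \<open>An expansion by constants keeps the elements, the sort N and the codes, so the instances
  at the codes are instances at all elements of N.\<close>

lemma satisfies_G_omega_if_codes:
  assumes "\<And>a. a \<in> inN B \<Longrightarrow> \<exists>m i. a = Fn B (Code m i) []"
  shows "satisfies_G_omega \<tau> B"
  unfolding satisfies_G_omega_def admissible_valuation_def
proof (intro allI impI conjI)
  fix C B' assume *: "constant_set \<tau> C \<and> is_str (sigma_ext \<tau> C) B' \<and> is_reduct (sigma \<tau>) B B'"
  have Dom: "Dom B' = Dom B" using * by (simp add: is_reduct_def)
  have const_Dom: "Fn B' c [] \<in> Dom B'" if "c \<in> C" for c
    using * that by (auto simp: is_str_def sigma_ext_def tuples_def)
  have N: "\<exists>m i. a = Fn B' (Code m i) []" if "a \<in> Dom B'" "Rl B' SortN [a]" for a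
  proof -
    have "Rl B SortN [a]" using * that by (auto simp: is_reduct_def sigma_def tuples_def)
    then have "a \<in> inN B" using that(1) Dom by (simp add: inN_def)
    then obtain m i where "a = Fn B (Code m i) []" using assms by metis
    then show ?thesis using * by (auto simp: is_reduct_def sigma_def tuples_def)
  qed
  show "forall_elim_admissible \<tau> C (true_in B')"
    unfolding forall_elim_admissible_def true_in_def
  proof (intro allI ballI impI)
    fix x \<psi> c and e :: "nat \<Rightarrow> _"
    assume c: "c \<in> C" and "\<forall>e. range e \<subseteq> Dom B' \<longrightarrow> sat B' e (Forall x \<psi>)" "range e \<subseteq> Dom B'"
    then have "sat B' (e(x := Fn B' c [])) \<psi>" using const_Dom[OF c] by auto
    moreover have "(\<lambda>i. tmval B' e ((Var(x := cst c)) i)) = e(x := Fn B' c [])" by auto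
    ultimately show "sat B' e (subst (Var(x := cst c)) \<psi>)" by (subst sat_subst) auto
  qed
  show "G_omega_admissible \<tau> C (true_in B')"
    unfolding G_omega_admissible_def
  proof (intro allI impI, elim conjE)
    fix n \<psi> ds
    assume inst: "\<forall>m i. true_in B' (psi_at \<psi> (cst (Code m i)) ds)" and n: "length ds = n"
    show "true_in B' (Forall n (Imp (isN (Var n)) (psi_at \<psi> (Var n) ds)))"
      unfolding true_in_def
    proof (intro allI impI)
      fix e :: "nat \<Rightarrow> _" assume e: "range e \<subseteq> Dom B'"
      have "sat B' (e(n := a)) (psi_at \<psi> (Var n) ds)"
        if a_N: "a \<in> Dom B'" "Rl B' SortN [a]" for a
      proof -
        obtain m i where a: "a = Fn B' (Code m i) []" using N[OF a_N] by metis
        have "sat B' e (psi_at \<psi> (cst (Code m i)) ds)" using inst e by (auto simp: true_in_def)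
        \<comment> \<open>Both sides evaluate \<open>\<psi>\<close> at the same assignment: the
          named values below \<open>n\<close>, the element \<open>a\<close> at \<open>n\<close>, and
          \<open>e\<close> above.\<close>
        also have "sat B' e (psi_at \<psi> (cst (Code m i)) ds) = sat B' (e(n := a)) (psi_at \<psi> (Var n) ds)"
          using n a by (subst (1 2) sat_psi_at) (auto intro!: sat_cong)
        finally show ?thesis .
      qed
      then show "sat B' e (Forall n (Imp (isN (Var n)) (psi_at \<psi> (Var n) ds)))" by simp
    qed
  qed
qed

text \<open>The given structure may exhaust the ambient type, so it is copied along \<open>h\<close>
  to leave space for the codes, which make up N. As \<open>g\<close> is meaningless outside the
  copy, relations are guarded by membership in it; \<open>hd as\<close> is the value that
  \<open>is_sigma_str\<close> prescribes when some argument is outside V.\<close>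

definition hat_str :: "(nat \<Rightarrow> nat \<Rightarrow> ('f, 'r) fm) \<Rightarrow> ('u \<Rightarrow> 'w) \<Rightarrow> (nat \<times> nat \<Rightarrow> 'w)
    \<Rightarrow> ('f, 'r, 'u) str \<Rightarrow> ('f sfun, 'r srel, 'w) str" where
  "hat_str E h c M =
     (let V = h ` Dom M; g = inv_into (Dom M) h in
      \<lparr>Dom = V \<union> range c,
       Fn = (\<lambda>f as. case f of
          TauF f \<Rightarrow> if set as \<subseteq> V then h (Fn M f (map g as)) else hd as
        | Code n i \<Rightarrow> c (n, i)
        | New k \<Rightarrow> undefined),
       Rl = (\<lambda>r as. case r of
          TauR r \<Rightarrow> set as \<subseteq> V \<and> Rl M r (map g as)
        | SortN \<Rightarrow> hd as \<in> range c
        | SortV \<Rightarrow> hd as \<in> V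
        | RN n \<Rightarrow> set (tl as) \<subseteq> V \<and>
            (\<exists>i. hd as = c (n, i) \<and> sat M (nth (map g (tl as))) (E n i)))\<rparr>)"

lemma hat_str_simps:
  "Dom (hat_str E h c M) = h ` Dom M \<union> range c"
  "Fn (hat_str E h c M) (TauF f) as =
     (if set as \<subseteq> h ` Dom M then h (Fn M f (map (inv_into (Dom M) h) as)) else hd as)"
  "Fn (hat_str E h c M) (Code n i) as = c (n, i)"
  "Rl (hat_str E h c M) (TauR r) as \<longleftrightarrow>
     set as \<subseteq> h ` Dom M \<and> Rl M r (map (inv_into (Dom M) h) as)"
  "Rl (hat_str E h c M) SortN as \<longleftrightarrow> hd as \<in> range c"
  "Rl (hat_str E h c M) SortV as \<longleftrightarrow> hd as \<in> h ` Dom M"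
  "Rl (hat_str E h c M) (RN n) as \<longleftrightarrow> set (tl as) \<subseteq> h ` Dom M \<and>
     (\<exists>i. hd as = c (n, i) \<and> sat M (nth (map (inv_into (Dom M) h) (tl as))) (E n i))"
  by (simp_all add: hat_str_def Let_def)

lemma inN_hat_str: "inN (hat_str E h c M) = range c"
  by (auto simp: inN_def hat_str_simps)

lemma inV_hat_str: "inV (hat_str E h c M) = h ` Dom M"
  by (auto simp: inV_def hat_str_simps)

lemma satisfies_G_omega_hat_str: "satisfies_G_omega \<tau> (hat_str E h c M)"
  by (rule satisfies_G_omega_if_codes) (auto simp: inN_hat_str hat_str_simps)

lemma map_inv_into_map:
  assumes "inj_on h A" "set as \<subseteq> A"
  shows "map (inv_into A h) (map h as) = as"
  using assms by (auto simp: subset_iff intro!: map_idI)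

text \<open>On images under \<open>h\<close> the inverse used in \<open>hat_str\<close> cancels. The
  vocabulary is arbitrary, so the lemma serves reducts as well.\<close>

lemma iso_by_Vpart_hat_str:
  assumes "inj_on h (Dom M)"
  shows "iso_by \<tau> h M (Vpart (hat_str E h c M))"
  using assms unfolding iso_by_def Vpart_def
  by (auto simp: inV_hat_str hat_str_simps bij_betw_def tuples_def map_inv_into_map
      simp del: map_map)

lemma is_sigma_str_hat_str:
  assumes M: "is_str \<tau> M" and h: "inj_on h (Dom M)" and disj: "h ` Dom M \<inter> range c = {}"
  shows "is_sigma_str \<tau> (hat_str E h c M)" (is "is_sigma_str \<tau> ?B")
proof -
  have V: "Fn ?B (TauF f) as \<in> h ` Dom M"
    if "Fsig \<tau> f = Some k" "as \<in> tuples ?B k" "set as \<subseteq> h ` Dom M" for f k as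
  proof -
    have "map (inv_into (Dom M) h) as \<in> tuples M k"
      using that by (auto simp: tuples_def subset_iff intro!: inv_into_into)
    then have "Fn M f (map (inv_into (Dom M) h) as) \<in> Dom M"
      using M that by (auto simp: is_str_def)
    then show ?thesis using that by (auto simp: hat_str_simps)
  qed
  have not_V: "Fn ?B (TauF f) as = hd as" if "\<not> set as \<subseteq> h ` Dom M" for f as
    using that by (auto simp: hat_str_simps)
  have "Fn ?B f as \<in> Dom ?B" if *: "Fsig (sigma \<tau>) f = Some k" "as \<in> tuples ?B k" for f k as
  proof (cases f)
    case (TauF g)
    show ?thesis
    proof (cases "set as \<subseteq> h ` Dom M")
      case True
      then show ?thesis using V[of g k as] * TauF by (auto simp: sigma_def hat_str_simps(1))
    next
      case False
      \<comment> \<open>The entries of the empty tuple lie trivially in V, so here a first argument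
        exists and \<open>hd as\<close> is an entry of the tuple.\<close>
      then have "as \<noteq> []" by auto
      then have "hd as \<in> Dom ?B" using * by (auto simp: tuples_def)
      then show ?thesis using False TauF not_V by simp
    qed
  qed (use * in \<open>auto simp: sigma_def hat_str_simps\<close>)
  moreover have "Dom M \<noteq> {}" using M by (simp add: is_str_def)
  ultimately show ?thesis
    using V not_V disj unfolding is_sigma_str_def is_str_def inN_hat_str inV_hat_str
    by (auto simp: hat_str_simps(1,4-))
qed

lemma hat_model_hat_str:
  fixes M :: "('f, 'r, 'u) str"
  assumes T: "T \<subseteq> sentences \<tau>" and enum: "enumerates_principal_types TYPE('u) \<tau> T E"
    and M: "atomic_model \<tau> T M" and h: "inj_on h (Dom M)"
    and c: "inj c" and disj: "h ` Dom M \<inter> range c = {}"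
  shows "hat_model \<tau> T E (hat_str E h c M)" (is "hat_model \<tau> T E ?B")
proof -
  have str: "is_str \<tau> M" and model: "model_of \<tau> T M"
    using M by (auto simp: atomic_model_def model_of_def)
  have sigma: "is_sigma_str \<tau> ?B" using str h disj by (rule is_sigma_str_hat_str)
  have iso: "iso_by \<tau> h M (Vpart ?B)" using h by (rule iso_by_Vpart_hat_str)
  let ?g = "inv_into (Dom M) h"
  obtain a0 where a0: "a0 \<in> Dom M" using str by (auto simp: is_str_def)
  have args: "map ?g (map e [0..<n]) \<in> tuples M n" if "\<forall>i<n. e i \<in> h ` Dom M" for e n
    using that by (auto simp: tuples_def intro!: inv_into_into)
  have allV: "sat ?B e (allV n) \<longleftrightarrow> (\<forall>i<n. e i \<in> h ` Dom M)" for e n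
    by (simp add: sat_BigConj hat_str_simps)
  have relV: "sat ?B e (relV (E n i)) \<longleftrightarrow> sat M (nth (map ?g (map e [0..<n]))) (E n i)"
    if "\<forall>i<n. e i \<in> h ` Dom M" for e n i
  proof -
    \<comment> \<open>The first \<open>n\<close> values are pulled back to \<open>M\<close>, with
      \<open>a0\<close> as a default elsewhere, so that \<open>sat_iso\<close> applies.\<close>
    define e' where "e' = (\<lambda>j. if j < n then ?g (e j) else a0)"
    have e': "range e' \<subseteq> Dom M" using that a0 by (auto simp: e'_def intro!: inv_into_into)
    have "sat ?B e (relV (E n i)) = sat (Vpart ?B) (h \<circ> e') (E n i)"
      unfolding sat_relV using that E_wf(2)[OF enum, of n i]
      by (intro sat_cong) (auto simp: e'_def f_inv_into_f)
    also have "\<dots> = sat M e' (E n i)" using sat_iso[OF iso str E_wf(1)[OF enum] e'] .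
    also have "\<dots> = sat M (nth (map ?g (map e [0..<n]))) (E n i)"
      using E_wf(2)[OF enum, of n i] by (intro sat_cong) (auto simp: e'_def)
    finally show ?thesis .
  qed
  have Rn: "sat ?B e (Rn n t) \<longleftrightarrow> (\<forall>i<n. e i \<in> h ` Dom M) \<and>
      (\<exists>i. tmval ?B e t = c (n, i) \<and> sat M (nth (map ?g (map e [0..<n]))) (E n i))" for e n t
    by (auto simp: hat_str_simps comp_def)
  have "true_in ?B p" if "p \<in> That T E" for p
    using that unfolding That_def
  proof (elim UnE)
    assume "p \<in> relV ` T"
    then obtain q where q: "p = relV q" "q \<in> T" by auto
    then have "fm_in \<tau> q" "fv q = {}" "true_in M q"
      using T model by (auto simp: sentences_def model_of_def)
    moreover have "inV ?B \<noteq> {}" using sigma by (simp add: is_sigma_str_def)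
    ultimately show ?thesis using q true_in_iso[OF iso str] by (simp add: true_in_relV)
  next
    assume "p \<in> {Neg (Eq (cst (Code n i)) (cst (Code m j))) | n i m j. (n, i) \<noteq> (m, j)}"
    then show ?thesis using c by (auto simp: true_in_def hat_str_simps dest: injD)
  next
    assume "p \<in> {isN (cst (Code n i)) | n i. True}"
    then show ?thesis by (auto simp: true_in_def hat_str_simps)
  next
    assume "p \<in> {Foralls n (Imp (allV n) (Iff (Rn n (cst (Code n i))) (relV (E n i)))) | n i. True}"
    then obtain n i where
      p: "p = Foralls n (Imp (allV n) (Iff (Rn n (cst (Code n i))) (relV (E n i))))" by auto
    \<comment> \<open>Injectivity of \<open>c\<close> leaves only the index \<open>i\<close> in the
      existential of \<open>Rn\<close>.\<close>
    have "tmval ?B e (cst (Code n i)) = c (n, j) \<longleftrightarrow> j = i" for e j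
      using c by (auto simp: hat_str_simps dest: injD)
    then show ?thesis
      unfolding p true_in_Foralls unfolding true_in_def sat.simps(1,4) allV Rn
      by (simp add: relV)
  next
    assume "p \<in> {Foralls n (Neg (Rn n (cst (Code m i)))) | n m i. m \<noteq> n}"
    then obtain n m i where p: "p = Foralls n (Neg (Rn n (cst (Code m i))))" "m \<noteq> n" by auto
    then have ne: "tmval ?B e (cst (Code m i)) \<noteq> c (n, j)" for e j
      using c by (auto simp: hat_str_simps dest: injD)
    then show ?thesis
      unfolding p(1) true_in_Foralls unfolding true_in_def sat.simps(1,4) Rn
      using ne by blast
  next
    assume "p \<in> {Foralls n (Imp (allV n) (Exists n (Conj (isN (Var n)) (Rn n (Var n))))) | n. True}"
    then obtain n where
      p: "p = Foralls n (Imp (allV n) (Exists n (Conj (isN (Var n)) (Rn n (Var n)))))" by auto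
    show ?thesis unfolding p true_in_Foralls unfolding true_in_def
    proof (intro allI impI)
      fix e :: "nat \<Rightarrow> _"
      have "\<exists>a \<in> Dom ?B. sat ?B (e(n := a)) (Conj (isN (Var n)) (Rn n (Var n)))"
        if e: "\<forall>i<n. e i \<in> h ` Dom M"
      proof -
        have "principal TYPE('u) \<tau> T (tp \<tau> M (map ?g (map e [0..<n])))"
          using M args[OF e] by (auto simp: atomic_model_def)
        then obtain i where i: "sat M (nth (map ?g (map e [0..<n]))) (E n i)"
          using principal_tp_iff[OF enum model args[OF e]] by blast
        \<comment> \<open>The code of the formula satisfied by the tuple is the witness; placed at
          variable \<open>n\<close>, it leaves the tuple in the variables below \<open>n\<close>
          intact.\<close>
        have "map (e(n := c (n, i))) [0..<n] = map e [0..<n]" by simp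
        then have "sat ?B (e(n := c (n, i))) (Rn n (Var n))" unfolding Rn using e i by auto
        moreover have "sat ?B (e(n := c (n, i))) (isN (Var n))" by (simp add: hat_str_simps)
        ultimately show ?thesis
          by (intro bexI[of _ "c (n, i)"]) (auto simp: hat_str_simps(1))
      qed
      then show "sat ?B e (Imp (allV n) (Exists n (Conj (isN (Var n)) (Rn n (Var n)))))"
        using allV[of e n] by auto
    qed
  qed
  then show ?thesis using sigma by (auto simp: hat_model_def model_of_def is_sigma_str_def)
qed

section \<open>Room for the codes, and structural equivalence\<close>

text \<open>An infinite set absorbs a countable summand. An injection of the sum into
  \<open>'u\<close> splits into \<open>h\<close> on the left and, after coding pairs by numbers,
  \<open>c\<close> on the right.\<close>

lemma infinite_inj_disjoint_codes:
  includes cardinal_syntax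
  assumes "infinite (UNIV :: 'u set)"
  obtains h :: "'u \<Rightarrow> 'u" and c :: "nat \<times> nat \<Rightarrow> 'u"
  where "inj h" "inj c" "range h \<inter> range c = {}"
proof -
  have "|UNIV :: nat set| \<le>o |UNIV :: 'u set|"
    using assms by (simp add: infinite_iff_card_of_nat)
  then have "|(UNIV :: 'u set) <+> (UNIV :: nat set)| =o |UNIV :: 'u set|"
    using assms by (intro card_of_Plus_infinite1)
  then have "|(UNIV :: 'u set) <+> (UNIV :: nat set)| \<le>o |UNIV :: 'u set|"
    by (rule ordIso_imp_ordLeq)
  then obtain f :: "'u + nat \<Rightarrow> 'u" where f: "inj f"
    unfolding card_of_ordLeq[symmetric] by auto
  show thesis
  proof
    show "inj (f \<circ> Inl)" using f by (auto simp: inj_def)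
    show "inj (f \<circ> Inr \<circ> (to_nat :: nat \<times> nat \<Rightarrow> nat))"
      by (intro inj_compose f) simp_all
    show "range (f \<circ> Inl) \<inter> range (f \<circ> Inr \<circ> (to_nat :: nat \<times> nat \<Rightarrow> nat)) = {}"
      using f by (auto simp: inj_def)
  qed
qed

lemma is_str_subvoc:
  assumes "subvoc \<tau> \<tau>'" "is_str \<tau>' M"
  shows "is_str \<tau> M"
  using assms unfolding subvoc_def is_str_def map_le_def by (metis domI)

lemma iso_by_reduct:
  assumes "is_reduct \<tau> M M'" "iso_by \<tau> h M' N" "is_str \<tau> M"
  shows "iso_by \<tau> h M N"
proof -
  have "tuples M k = tuples M' k" for k using assms(1) by (simp add: is_reduct_def tuples_def)
  with assms show ?thesis by (simp add: is_reduct_def iso_by_def)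
qed

text \<open>The second claim compares structures up to isomorphism because \<open>M\<close> may
  exhaust the ambient type, which has to hold the codes too.\<close>

theorem theorem5p1p14:
  fixes \<tau> \<tau>\<phi> :: "('f, 'r) voc"
    and \<phi> :: "('f, 'r) ifm"
    and T :: "('f, 'r) fm set"
    and E :: "nat \<Rightarrow> nat \<Rightarrow> ('f, 'r) fm"
  assumes infinite_universe: "infinite (UNIV :: 'u set)"
    and complete: "complete_isentence TYPE('u) \<tau> \<phi>"
    and voc: "subvoc \<tau> \<tau>\<phi>" "countable_voc \<tau>\<phi>"
    and theory_T: "T \<subseteq> sentences \<tau>\<phi>"
    and chang: "\<forall>M :: ('f, 'r, 'u) str. is_str \<tau> M \<longrightarrow>
      (imodel_of \<tau> \<phi> M \<longleftrightarrow> (\<exists>M'. atomic_model \<tau>\<phi> T M' \<and> is_reduct \<tau> M M'))"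
    and enum: "enumerates_principal_types TYPE('u) \<tau>\<phi> T E"
  shows "(\<forall>B :: ('f sfun, 'r srel, 'u) str.
            hat_model \<tau>\<phi> T E B \<and> satisfies_G_omega \<tau>\<phi> B \<longrightarrow> atomic_model \<tau>\<phi> T (Vpart B))
       \<and> {M :: ('f, 'r, 'u) str. imodel_of \<tau> \<phi> M} =
         {M. is_str \<tau> M \<and> (\<exists>B :: ('f sfun, 'r srel, 'u) str.
               hat_model \<tau>\<phi> T E B \<and> satisfies_G_omega \<tau>\<phi> B \<and> iso_str \<tau> M (Vpart B))}"
proof (intro conjI allI impI set_eqI iffI)
  fix B :: "('f sfun, 'r srel, 'u) str"
  assume "hat_model \<tau>\<phi> T E B \<and> satisfies_G_omega \<tau>\<phi> B"
  then show "atomic_model \<tau>\<phi> T (Vpart B)"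
    using atomic_model_Vpart[OF voc(2) theory_T enum] by blast
next
  fix M :: "('f, 'r, 'u) str"
  assume "M \<in> {M. imodel_of \<tau> \<phi> M}"
  then have M: "is_str \<tau> M" "imodel_of \<tau> \<phi> M" by (auto simp: imodel_of_def)
  then obtain M' where M': "atomic_model \<tau>\<phi> T M'" "is_reduct \<tau> M M'" using chang by blast
  obtain h :: "'u \<Rightarrow> 'u" and c :: "nat \<times> nat \<Rightarrow> 'u"
    where hc: "inj h" "inj c" "range h \<inter> range c = {}"
    using infinite_inj_disjoint_codes[OF infinite_universe] .
  let ?B = "hat_str E h c M'"
  have h: "inj_on h (Dom M')" using hc(1) by (rule inj_on_subset) simp
  have "hat_model \<tau>\<phi> T E ?B"
    using hc by (intro hat_model_hat_str theory_T enum M'(1) h) auto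
  \<comment> \<open>\<open>iso_by_Vpart_hat_str\<close> is taken in the smaller vocabulary
    \<open>\<tau>\<close>, where \<open>M\<close> and \<open>M'\<close> agree.\<close>
  moreover have "iso_by \<tau> h M (Vpart ?B)"
    using M'(2) iso_by_Vpart_hat_str[OF h] M(1) by (rule iso_by_reduct)
  ultimately show "M \<in> {M. is_str \<tau> M \<and> (\<exists>B :: ('f sfun, 'r srel, 'u) str.
               hat_model \<tau>\<phi> T E B \<and> satisfies_G_omega \<tau>\<phi> B \<and> iso_str \<tau> M (Vpart B))}"
    using M(1) satisfies_G_omega_hat_str iso_str_iff by blast
next
  fix M :: "('f, 'r, 'u) str"
  assume "M \<in> {M. is_str \<tau> M \<and> (\<exists>B :: ('f sfun, 'r srel, 'u) str.
               hat_model \<tau>\<phi> T E B \<and> satisfies_G_omega \<tau>\<phi> B \<and> iso_str \<tau> M (Vpart B))}"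
  then obtain B :: "('f sfun, 'r srel, 'u) str" and h where M: "is_str \<tau> M"
    and B: "hat_model \<tau>\<phi> T E B" "satisfies_G_omega \<tau>\<phi> B" and h: "iso_by \<tau> h M (Vpart B)"
    by (auto simp: iso_str_iff)
  have atomic: "atomic_model \<tau>\<phi> T (Vpart B)"
    using voc(2) theory_T enum B by (rule atomic_model_Vpart)
  then have "is_str \<tau> (Vpart B)"
    using is_str_subvoc[OF voc(1)] by (auto simp: atomic_model_def model_of_def)
  moreover have "is_reduct \<tau> (Vpart B) (Vpart B)" by (simp add: is_reduct_def)
  ultimately have "imodel_of \<tau> \<phi> (Vpart B)" using chang atomic by blast
  \<comment> \<open>Isomorphisms preserve formulas of their vocabulary, so \<open>\<phi>\<close> has
    to be one for its truth to pass from \<open>Vpart B\<close> to \<open>M\<close>.\<close>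
  moreover have "ifm_in \<tau> \<phi>" using complete by (simp add: complete_isentence_def isentences_def)
  ultimately show "M \<in> {M. imodel_of \<tau> \<phi> M}" using imodel_of_iso[OF h M] by simp
qed

end
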